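(* The crown triangles partition the nonnegative integers: $$\mathbb{Z}_{\ge 0}=\bigsqcup_{c\in\mathscr{C}}\mathcal{T}_c .$$ Every nonnegative integer belongs to exactly one crown triangle at exactly one position; that is, for every $n\in\mathbb{Z}_{\ge 0}$ there is exactly one triple $(c,k,j)$ with $c\in\mathscr{C}$, $k\ge 0$ and $0\le j\le 2k$ such that $\mathcal{T}_c(k,j)=n$.
   Context: A nonnegative integer $c$ is a crown if $c\equiv 0$ or $8\pmod{12}$; $\mathscr{C}$ denotes the set of crowns. For a crown $c$ put $\lambda=\lambda(c)=(c+2)/2$. For integers $k\ge 0$ and $0\le j\le 2k$ define $R(k,j)=2^{k-\lfloor j/2\rfloor}\cdot 3^{\lfloor j/2\rfloor}$. Let $g(j)=2$ if $j$ is even and $g(j)=1$ if $j$ is odd. The crown triangle $\mathcal{T}_c$ has, for each $k\ge 0$ and $0\le j\le 2k$, the element $\mathcal{T}_c(k,j)=g(j)\,(\lambda R(k,j)-1)$ at position $(k,j)$; row $k$ consists of the positions $j=0,1,\dots,2k$. When regarded as a set, $\mathcal{T}_c$ is the set of all its elements. *)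

theory Defs
  imports Main "HOL-Number_Theory.Cong" "HOL-Library.Disjoint_Sets"
begin

definition crowns :: "nat set" where
  "crowns = {c. [c = 0] (mod 12) \<or> [c = 8] (mod 12)}"

text \<open>Crowns are even, so the integer division is exact on them.\<close>
definition lam :: "nat \<Rightarrow> int" where
  "lam c = (int c + 2) div 2"

text \<open>Only used for \<open>j \<le> 2 * k\<close>, where the natural number subtraction is not truncated.\<close>
definition R :: "nat \<Rightarrow> nat \<Rightarrow> int" where
  "R k j = 2 ^ (k - j div 2) * 3 ^ (j div 2)"

definition g :: "nat \<Rightarrow> int" where
  "g j = (if even j then 2 else 1)"

text \<open>Elements are integers so that the subtraction of 1 is the true one.\<close>
definition crown_elem :: "nat \<Rightarrow> nat \<Rightarrow> nat \<Rightarrow> int" where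
  "crown_elem c k j = g j * (lam c * R k j - 1)"

definition crown_triangle :: "nat \<Rightarrow> int set" where
  "crown_triangle c = {crown_elem c k j | k j. j \<le> 2 * k}"

end

theory Submission imports Defs begin

text \<open>
  As \<open>c\<close> runs through the crowns, \<open>lam c\<close> runs exactly once through the positive integers prime
  to 6 (\<open>bij_betw_lam_crowns\<close>). Splitting off the powers of 2 and 3 therefore writes each
  positive integer in exactly one way as \<open>lam c * 2 ^ a * 3 ^ b\<close> (\<open>crown_factorization\<close>).

  The entry at position \<open>(k, j)\<close> with \<open>j \<le> 2 * k\<close> encodes such a factorization, with
  \<open>a = k - j div 2\<close> and \<open>b = j div 2\<close>. For even \<open>j\<close> the entry is twice the product less 2,
  so it is even and any \<open>a\<close> may occur. For odd \<open>j\<close> the bound \<open>j \<le> 2 * k\<close> forces \<open>a > 0\<close>; the entry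
  is an even product less 1, hence odd. So an even \<open>n\<close> occurs once, from the factorization of
  \<open>n div 2 + 1\<close>, and an odd \<open>n\<close> occurs once, from the factorization of the even number \<open>n + 1\<close>.
\<close>

lemma crownE:
  assumes "c \<in> crowns"
  obtains m where "c = 12 * m" "lam c = 6 * int m + 1"
  | m where "c = 12 * m + 8" "lam c = 6 * int m + 5"
proof -
  consider "c mod 12 = 0" | "c mod 12 = 8"
    using assms by (auto simp: crowns_def cong_def)
  then show thesis
  proof cases
    case 1
    then have "c = 12 * (c div 12)" by presburger
    then show thesis by (rule that(1)) (subst \<open>c = _\<close>, simp add: lam_def)
  next
    case 2
    then have "c = 12 * (c div 12) + 8" by presburger
    then show thesis by (rule that(2)) (subst \<open>c = _\<close>, simp add: lam_def)
  qed
qed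

text \<open>
  The two residues 0 and 8 modulo 12 become the two units 1 and 5 modulo 6 under
  \<open>c \<mapsto> c div 2 + 1\<close>, whose inverse is \<open>x \<mapsto> 2 * x - 2\<close>.
\<close>

lemma bij_betw_lam_crowns:
  "bij_betw lam crowns {x. 0 < x \<and> odd x \<and> \<not> 3 dvd x}"
proof (rule bij_betw_byWitness[where f' = "\<lambda>x. nat (2 * x - 2)"])
  show "\<forall>c\<in>crowns. nat (2 * lam c - 2) = c"
    by (auto elim!: crownE)
  show "\<forall>x\<in>{x. 0 < x \<and> odd x \<and> \<not> 3 dvd x}. lam (nat (2 * x - 2)) = x"
    by (auto simp: lam_def)
  show "lam ` crowns \<subseteq> {x. 0 < x \<and> odd x \<and> \<not> 3 dvd x}"
  proof (intro image_subsetI CollectI)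
    fix c assume "c \<in> crowns"
    then show "0 < lam c \<and> odd (lam c) \<and> \<not> 3 dvd lam c"
      by (cases rule: crownE) presburger+
  qed
  show "(\<lambda>x. nat (2 * x - 2)) ` {x. 0 < x \<and> odd x \<and> \<not> 3 dvd x} \<subseteq> crowns"
  proof (intro image_subsetI)
    fix x :: int assume "x \<in> {x. 0 < x \<and> odd x \<and> \<not> 3 dvd x}"
    then have "0 < x" "x mod 6 = 1 \<or> x mod 6 = 5" by simp_all presburger
    moreover define m where "m = x div 6"
    ultimately have "0 \<le> m" "x = 6 * m + 1 \<or> x = 6 * m + 5" by presburger+
    then have "nat (2 * x - 2) = 12 * nat m \<or> nat (2 * x - 2) = 12 * nat m + 8" by auto
    then show "nat (2 * x - 2) \<in> crowns"
      by (elim disjE) (simp_all add: crowns_def cong_def)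
  qed
qed

lemma lam_crown:
  assumes "c \<in> crowns"
  shows "0 < lam c" "odd (lam c)" "\<not> 3 dvd lam c"
  using bij_betw_apply[OF bij_betw_lam_crowns assms] by auto

lemma multiplicity_power_mult:
  fixes p q x :: int
  assumes "prime p" "\<not> p dvd x" "prime q" "\<not> p dvd q"
  shows "multiplicity p (x * p ^ a * q ^ b) = a"
proof (rule multiplicity_eqI)
  show "\<not> p ^ Suc a dvd x * p ^ a * q ^ b"
  proof
    assume "p ^ Suc a dvd x * p ^ a * q ^ b"
    then have "p ^ a * p dvd p ^ a * (x * q ^ b)" by (simp add: ac_simps)
    then have "p dvd x * q ^ b" using assms(1) by (simp add: prime_int_iff)
    then show False using assms by (meson prime_dvd_mult_iff prime_dvd_power)
  qed
qed simp

lemma exists_split_2_3: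
  fixes N :: int
  assumes "0 < N"
  shows "\<exists>x a b. 0 < x \<and> odd x \<and> \<not> 3 dvd x \<and> x * 2 ^ a * 3 ^ b = N"
proof -
  obtain y where y: "N = 2 ^ multiplicity 2 N * y" "\<not> 2 dvd y"
    using multiplicity_decompose'[of N 2] assms by auto
  have "y \<noteq> 0" using y assms by auto
  then obtain x where x: "y = 3 ^ multiplicity 3 y * x" "\<not> 3 dvd x"
    using multiplicity_decompose'[of y 3] by auto
  have "odd x" using x(1) y(2) by (metis dvd_mult)
  moreover have eq: "x * 2 ^ multiplicity 2 N * 3 ^ multiplicity 3 y = N"
    using x(1) y(1) by (metis mult.assoc mult.commute)
  moreover have "0 < x"
    using eq assms by (metis zero_less_mult_pos2 zero_less_numeral zero_less_power)
  ultimately show ?thesis using x(2) by blast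
qed

text \<open>
  Since \<open>lam c\<close> is prime to 6, the exponents must be the multiplicities of 2 and 3 in \<open>N\<close>; this
  determines \<open>lam c\<close>, and then \<open>c\<close> because \<open>lam\<close> is injective on crowns.
\<close>

lemma crown_factorization:
  assumes "0 < N"
  obtains c a b where "c \<in> crowns" "lam c * 2 ^ a * 3 ^ b = N"
    "\<And>c' a' b'. c' \<in> crowns \<Longrightarrow> lam c' * 2 ^ a' * 3 ^ b' = N \<Longrightarrow>
      c' = c \<and> a' = a \<and> b' = b"
proof -
  obtain x a b where "0 < x" "odd x" "\<not> 3 dvd x" and N: "x * 2 ^ a * 3 ^ b = N"
    using exists_split_2_3[OF assms] by blast
  then have "x \<in> lam ` crowns"
    using bij_betw_imp_surj_on[OF bij_betw_lam_crowns] by blast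
  then obtain c where c: "c \<in> crowns" "lam c * 2 ^ a * 3 ^ b = N" using N by blast
  have exponents: "a' = multiplicity 2 N \<and> b' = multiplicity 3 N"
    if "c' \<in> crowns" "lam c' * 2 ^ a' * 3 ^ b' = N" for c' a' b'
    using that(2) lam_crown[OF that(1)]
      multiplicity_power_mult[of 2 "lam c'" 3 a' b'] multiplicity_power_mult[of 3 "lam c'" 2 b' a']
    by (simp add: ac_simps)
  have "c' = c \<and> a' = a \<and> b' = b"
    if "c' \<in> crowns" "lam c' * 2 ^ a' * 3 ^ b' = N" for c' a' b'
  proof -
    have ab: "a' = a" "b' = b" using exponents[OF that] exponents[OF c] by auto
    then have "lam c' = lam c" using that(2) c(2) by auto
    then show ?thesis
      using ab bij_betw_imp_inj_on[OF bij_betw_lam_crowns] that(1) c(1) by (auto dest: inj_onD)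
  qed
  with c show thesis by (rule that)
qed

lemma even_crown_elem_iff:
  assumes "j \<le> 2 * k"
  shows "even (crown_elem c k j) \<longleftrightarrow> even j"
proof (cases "even j")
  case False
  then have "0 < k - j div 2" using assms by presburger
  then show ?thesis using False by (simp add: crown_elem_def g_def R_def)
qed (simp add: crown_elem_def g_def)

lemma crown_elem_nonneg:
  assumes "c \<in> crowns"
  shows "0 \<le> crown_elem c k j"
proof -
  have "0 < lam c * R k j" using lam_crown(1)[OF assms] by (simp add: R_def)
  then show ?thesis by (simp add: crown_elem_def g_def)
qed

text \<open>
  The parity of an entry is that of \<open>j\<close>, so \<open>n\<close> alone decides which of the two shapes of entry
  applies, and hence which number \<open>N\<close> is factored.
\<close>

lemma crown_elem_eq_iff:
  assumes "j \<le> 2 * k"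
  defines "N \<equiv> \<lambda>n::int. if even n then n div 2 + 1 else n + 1"
  shows "crown_elem c k j = n \<longleftrightarrow>
    (even j \<longleftrightarrow> even n) \<and> lam c * 2 ^ (k - j div 2) * 3 ^ (j div 2) = N n"
proof (cases "even j \<longleftrightarrow> even n")
  case True
  then show ?thesis by (auto simp: crown_elem_def g_def R_def N_def ac_simps)
next
  case False
  then show ?thesis using even_crown_elem_iff[OF assms(1)] by blast
qed

lemma unique_crown_position:
  fixes n :: int
  assumes "0 \<le> n"
  shows "\<exists>!(c, k, j). c \<in> crowns \<and> j \<le> 2 * k \<and> crown_elem c k j = n"
proof -
  define N where "N = (if even n then n div 2 + 1 else n + 1)"
  have "0 < N" using assms by (auto simp: N_def)
  from crown_factorization[OF this] obtain c a b
    where c: "c \<in> crowns" "lam c * 2 ^ a * 3 ^ b = N"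
      and unique: "\<And>c' a' b'. c' \<in> crowns \<Longrightarrow> lam c' * 2 ^ a' * 3 ^ b' = N \<Longrightarrow>
        c' = c \<and> a' = a \<and> b' = b"
    by blast
  define j where "j = (if even n then 2 * b else 2 * b + 1)"
  have j: "j div 2 = b" "even j \<longleftrightarrow> even n" by (auto simp: j_def)
  have "0 < a" if "odd n"
  proof (rule ccontr)
    assume "\<not> 0 < a"
    then have "odd N" using c lam_crown(2)[OF c(1)] by auto
    then show False using that by (simp add: N_def)
  qed
  \<comment> \<open>An odd position \<open>2 * b + 1\<close> fits into row \<open>a + b\<close> only because \<open>a > 0\<close>.\<close>
  then have le: "j \<le> 2 * (a + b)" by (cases "even n") (auto simp: j_def)
  show ?thesis
  proof (rule ex1I[of _ "(c, a + b, j)"])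
    show "case (c, a + b, j) of (c, k, j) \<Rightarrow>
        c \<in> crowns \<and> j \<le> 2 * k \<and> crown_elem c k j = n"
      using c le j by (simp add: crown_elem_eq_iff N_def)
  next
    fix t
    assume "case t of (c, k, j) \<Rightarrow> c \<in> crowns \<and> j \<le> 2 * k \<and> crown_elem c k j = n"
    then obtain c' k' j' where t: "t = (c', k', j')"
      and pos: "c' \<in> crowns" "j' \<le> 2 * k'" "crown_elem c' k' j' = n" by (cases t) auto
    then have par: "even j' \<longleftrightarrow> even n"
      and "lam c' * 2 ^ (k' - j' div 2) * 3 ^ (j' div 2) = N"
      by (simp_all add: crown_elem_eq_iff N_def)
    then have eqs: "c' = c" "k' - j' div 2 = a" "j' div 2 = b" using unique pos(1) by blast+
    have "k' = a + b" using eqs(2,3) pos(2) by presburger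
    moreover have "j' = j" using eqs(3) par j by presburger
    ultimately show "t = (c, a + b, j)" using t eqs(1) by simp
  qed
qed

theorem theorem2p13:
  "partition_on {n::int. 0 \<le> n} (crown_triangle ` crowns)
   \<and> {n::int. 0 \<le> n} = (\<Union>c\<in>crowns. crown_triangle c)
   \<and> disjoint_family_on crown_triangle crowns
   \<and> (\<forall>n::int. 0 \<le> n \<longrightarrow>
        (\<exists>!(c, k, j). c \<in> crowns \<and> j \<le> 2 * k \<and> crown_elem c k j = n))"
proof (intro conjI)
  show unique: "\<forall>n::int. 0 \<le> n \<longrightarrow>
      (\<exists>!(c, k, j). c \<in> crowns \<and> j \<le> 2 * k \<and> crown_elem c k j = n)"
    using unique_crown_position by blast
  show union: "{n::int. 0 \<le> n} = (\<Union>c\<in>crowns. crown_triangle c)"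
  proof (intro equalityI subsetI)
    fix n :: int assume "n \<in> {n. 0 \<le> n}"
    then have "\<exists>!(c, k, j). c \<in> crowns \<and> j \<le> 2 * k \<and> crown_elem c k j = n"
      using unique by blast
    then obtain c k j where "c \<in> crowns" "j \<le> 2 * k" "n = crown_elem c k j" by auto
    then show "n \<in> (\<Union>c\<in>crowns. crown_triangle c)" by (auto simp: crown_triangle_def)
  qed (auto simp: crown_triangle_def crown_elem_nonneg)
  have same: "c = c'" if cs: "c \<in> crowns" "c' \<in> crowns"
    and n: "n \<in> crown_triangle c" "n \<in> crown_triangle c'" for c c' n
  proof -
    obtain k j k' j' where p: "j \<le> 2 * k" "crown_elem c k j = n"
        "j' \<le> 2 * k'" "crown_elem c' k' j' = n"
      using n by (auto simp: crown_triangle_def)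
    then have "0 \<le> n" using crown_elem_nonneg[OF cs(1)] by blast
    then have "\<exists>!(c, k, j). c \<in> crowns \<and> j \<le> 2 * k \<and> crown_elem c k j = n"
      using unique by blast
    then obtain t where t: "\<And>s. (case s of (c, k, j) \<Rightarrow>
        c \<in> crowns \<and> j \<le> 2 * k \<and> crown_elem c k j = n) \<Longrightarrow> s = t"
      by (rule ex1E) blast
    show ?thesis using t[of "(c, k, j)"] t[of "(c', k', j')"] cs p by auto
  qed
  show disjoint: "disjoint_family_on crown_triangle crowns"
    unfolding disjoint_family_on_def using same by blast
  have "crown_triangle c \<noteq> {}" for c
    by (auto simp: crown_triangle_def)
  then show "partition_on {n::int. 0 \<le> n} (crown_triangle ` crowns)"
    unfolding partition_on_def
    using union disjoint_family_on_disjoint_image[OF disjoint] by blast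
qed

end
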